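(* Let $p_i\in(0,1)$ for $i\in\mathbb Z$, and consider the nearest neighbor exclusion process on $\{0,1\}^{\mathbb Z}$ with jump probabilities $p_i$ (from $i$ to $i+1$) and $q_i=1-p_i$ (from $i$ to $i-1$). Let $\epsilon>0$. (a) Suppose that for each positive integer $n$ there exists $k\in\mathbb Z$ such that $p_i\ge\frac12-\epsilon$ for all $k\le i\le k+n$. Then $\phi(\mu)\ge-\epsilon$ for all $\mu\in\mathcal I$. (b) Suppose that for each positive integer $n$ there exists $k\in\mathbb Z$ such that $p_i\le\frac12+\epsilon$ for all $k\le i\le k+n$. Then $\phi(\mu)\le\epsilon$ for all $\mu\in\mathcal I$.
   Context: The exclusion process is the continuous time Markov (Feller) process $\eta_t$ on $\{0,1\}^{\mathbb Z}$ (product topology) whose generator acts on functions $f$ depending on finitely many coordinates by $$\mathcal L f(\eta)=\sum_{i\in\mathbb Z}\Big\{\eta(i)[1-\eta(i+1)]p_i+\eta(i+1)[1-\eta(i)]q_{i+1}\Big\}[f(\eta_{i,i+1})-f(\eta)],$$ where $\eta_{i,i+1}$ is obtained from $\eta$ by interchanging the $i$th and $(i+1)$st coordinates. $\mathcal I$ is the set of all stationary distributions of the process (probability measures on $\{0,1\}^{\mathbb Z}$ invariant under its evolution). Flux: for $\mu\in\mathcal I$, $$\phi(\mu)=p_i\,\mu\{\eta:\eta(i)=1,\eta(i+1)=0\}-q_{i+1}\,\mu\{\eta:\eta(i)=0,\eta(i+1)=1\},$$ which does not depend on $i\in\mathbb Z$. *)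

theory Defs
  imports "HOL-Probability.Probability"
begin

(* Configurations: True stands for an occupied site, False for an empty one.  The type
   int => bool carries the product of the discrete topologies; since the index set is countable
   its Borel sigma-algebra is the product sigma-algebra. *)

type_synonym config = "int \<Rightarrow> bool"

definition swap :: "config \<Rightarrow> int \<Rightarrow> config" where
  "swap \<eta> i = \<eta>(i := \<eta> (i + 1), i + 1 := \<eta> i)"

definition depends_on_finitely_many :: "(config \<Rightarrow> real) \<Rightarrow> bool" where
  "depends_on_finitely_many f \<longleftrightarrow>
     (\<exists>F. finite F \<and> (\<forall>\<eta> \<zeta>. (\<forall>i\<in>F. \<eta> i = \<zeta> i) \<longrightarrow> f \<eta> = f \<zeta>))"

(* For f depending on finitely many coordinates only finitely many summands are nonzero. *)

definition exclusion_generator ::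
    "(int \<Rightarrow> real) \<Rightarrow> (int \<Rightarrow> real) \<Rightarrow> (config \<Rightarrow> real) \<Rightarrow> config \<Rightarrow> real" where
  "exclusion_generator p q f \<eta> =
     (\<Sum>\<^sub>\<infinity>i\<in>UNIV.
        (of_bool (\<eta> i) * (1 - of_bool (\<eta> (i + 1))) * p i
         + of_bool (\<eta> (i + 1)) * (1 - of_bool (\<eta> i)) * q (i + 1))
        * (f (swap \<eta> i) - f \<eta>))"

definition transition_operator ::
    "(real \<Rightarrow> config \<Rightarrow> config measure) \<Rightarrow> real \<Rightarrow> (config \<Rightarrow> real) \<Rightarrow> config \<Rightarrow> real" where
  "transition_operator P t f \<eta> = (\<integral>\<zeta>. f \<zeta> \<partial>P t \<eta>)"

(* A time-homogeneous Feller process on the compact space of configurations is given by its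
   transition function: P t \<eta> is the law at time t of the process started from \<eta>.  The values
   of P at negative times are irrelevant. *)

definition feller_transition_function :: "(real \<Rightarrow> config \<Rightarrow> config measure) \<Rightarrow> bool" where
  "feller_transition_function P \<longleftrightarrow>
     (\<forall>t\<ge>0. P t \<in> borel \<rightarrow>\<^sub>M prob_algebra borel) \<and>
     (\<forall>\<eta>. P 0 \<eta> = return borel \<eta>) \<and>
     (\<forall>s\<ge>0. \<forall>t\<ge>0. \<forall>\<eta>. P (s + t) \<eta> = P s \<eta> \<bind> P t) \<and>
     (\<forall>f. continuous_on UNIV f \<longrightarrow>
        (\<forall>t\<ge>0. continuous_on UNIV (transition_operator P t f)) \<and>
        uniform_limit UNIV (\<lambda>t. transition_operator P t f) f (at_right 0))"

(* f is in the domain of the generator of P, and the generator maps f to g; the limit is taken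
   in the supremum norm. *)

definition generator_maps ::
    "(real \<Rightarrow> config \<Rightarrow> config measure) \<Rightarrow> (config \<Rightarrow> real) \<Rightarrow> (config \<Rightarrow> real) \<Rightarrow> bool" where
  "generator_maps P f g \<longleftrightarrow>
     uniform_limit UNIV (\<lambda>t \<eta>. (transition_operator P t f \<eta> - f \<eta>) / t) g (at_right 0)"

(* Functions of finitely many coordinates form a core for the generator when the rates are
   bounded, so for such rates these conditions determine P t for all t \<ge> 0. *)

definition exclusion_process ::
    "(int \<Rightarrow> real) \<Rightarrow> (int \<Rightarrow> real) \<Rightarrow> (real \<Rightarrow> config \<Rightarrow> config measure) \<Rightarrow> bool" where
  "exclusion_process p q P \<longleftrightarrow>
     feller_transition_function P \<and>
     (\<forall>f. depends_on_finitely_many f \<longrightarrow> generator_maps P f (exclusion_generator p q f))"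

definition stationary_distributions ::
    "(real \<Rightarrow> config \<Rightarrow> config measure) \<Rightarrow> config measure set" where
  "stationary_distributions P =
     {\<mu> \<in> space (prob_algebra borel). \<forall>t\<ge>0. \<mu> \<bind> P t = \<mu>}"

(* The flux is the common value, over all bonds (i, i + 1), of the net flow across the bond.  For
   a stationary \<mu> this net flow does not depend on i, so the description is proper. *)

definition flux ::
    "(int \<Rightarrow> real) \<Rightarrow> (int \<Rightarrow> real) \<Rightarrow> config measure \<Rightarrow> real" where
  "flux p q \<mu> =
     (THE c. \<forall>i. c = p i * measure \<mu> {\<eta>. \<eta> i \<and> \<not> \<eta> (i + 1)}
                   - q (i + 1) * measure \<mu> {\<eta>. \<not> \<eta> i \<and> \<eta> (i + 1)})"

end

theory Submission
  imports Defs
begin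

text \<open>
  Write \<open>\<rho> i\<close> for the probability that site \<open>i\<close> is occupied under a stationary \<open>\<mu>\<close>.
  The generator applied to the indicator of occupation of \<open>i\<close> has \<open>\<mu>\<close>-integral 0
  (\<open>integral_generator_eq_0\<close>), which says that the net flow across the bond \<open>(i - 1, i)\<close> equals
  that across \<open>(i, i + 1)\<close>; so the flux is the net flow across any bond (\<open>net_flow_eq_flux\<close>).

  Let \<open>a\<close> and \<open>b\<close> be the probabilities of the patterns 10 and 01 at \<open>(i, i + 1)\<close>.  Then
  \<open>a - b = \<rho> i - \<rho> (i + 1)\<close> and \<open>a + b \<le> 1\<close>.  Hence, if \<open>p i\<close> and \<open>p (i + 1)\<close> are at least
  \<open>1/2 - \<epsilon>\<close>, the net flow is at least
  \<open>(1/2 - \<epsilon>) a - (1/2 + \<epsilon>) b = (\<rho> i - \<rho> (i + 1)) / 2 - \<epsilon> (a + b) \<ge> (\<rho> i - \<rho> (i + 1)) / 2 - \<epsilon>\<close>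
  (\<open>net_flow_lower_bound\<close>).  The density difference telescopes over \<open>n\<close> consecutive bonds, so
  \<open>n\<close> times the flux is at least \<open>- 1/2 - n \<epsilon>\<close>; divide by \<open>n\<close> and let \<open>n\<close> tend to infinity.
  The upper bound follows in the same way from
  \<open>(1/2 + \<epsilon>) a - (1/2 - \<epsilon>) b = (\<rho> i - \<rho> (i + 1)) / 2 + \<epsilon> (a + b)\<close>.
\<close>

section \<open>Stationarity and the generator\<close>

lemma sets_occupied [measurable]: "{\<eta> :: config. \<eta> i} \<in> sets borel"
proof -
  have "open ((\<lambda>\<eta> :: config. \<eta> i) -` {True})"
    by (intro open_vimage continuous_on_product_coordinates)
       (rule discrete_topology_class.open_discrete)
  then show ?thesis
    by (simp add: vimage_def)
qed

lemma measurable_pred_occupied [measurable]: "Measurable.pred borel (\<lambda>\<eta> :: config. \<eta> i)"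
  using sets_occupied[of i] by (simp add: pred_def)

lemma stationary_distributionD:
  assumes "\<mu> \<in> stationary_distributions P"
  shows "prob_space \<mu>" "sets \<mu> = sets borel" "space \<mu> = UNIV"
    and "t \<ge> 0 \<Longrightarrow> \<mu> \<bind> P t = \<mu>"
  using assms sets_eq_imp_space_eq[of \<mu> borel]
  by (auto simp: stationary_distributions_def space_prob_algebra)

text \<open>
  For each \<open>t > 0\<close> the difference quotient that approximates \<open>g\<close> uniformly has \<open>\<mu>\<close>-integral 0 by
  stationarity.
\<close>

lemma integral_generator_eq_0:
  assumes P: "feller_transition_function P" and \<mu>: "\<mu> \<in> stationary_distributions P"
    and A [measurable]: "A \<in> sets borel"
    and g [measurable]: "g \<in> borel_measurable borel"
    and bounded: "\<And>\<eta>. \<bar>g \<eta>\<bar> \<le> B"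
    and gen: "generator_maps P (indicator A) g"
  shows "(\<integral>\<eta>. g \<eta> \<partial>\<mu>) = 0"
proof -
  interpret prob_space \<mu> using \<mu> by (rule stationary_distributionD)
  note [measurable_cong] = stationary_distributionD(2)[OF \<mu>]
  have int_g: "integrable \<mu> g"
    by (rule integrable_const_bound[where B = B]) (auto simp: bounded)
  have "\<bar>\<integral>\<eta>. g \<eta> \<partial>\<mu>\<bar> \<le> e" if "e > 0" for e
  proof -
    let ?d = "\<lambda>t \<eta>. (transition_operator P t (indicator A) \<eta> - indicator A \<eta>) / t"
    have "\<forall>\<^sub>F t in at_right 0. (\<forall>\<eta>\<in>UNIV. dist (?d t \<eta>) (g \<eta>) < e) \<and> (t :: real) > 0"
      using uniform_limitD[OF gen[unfolded generator_maps_def] that] eventually_at_right_less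
      by (rule eventually_conj)
    then obtain t :: real where t: "t > 0" and close: "\<And>\<eta>. dist (?d t \<eta>) (g \<eta>) < e"
      by (auto dest!: eventually_happens'[rotated])
    have Pt: "P t \<in> borel \<rightarrow>\<^sub>M prob_algebra borel"
      using P t by (simp add: feller_transition_function_def)
    then have Pt' [measurable]: "P t \<in> borel \<rightarrow>\<^sub>M subprob_algebra borel"
      by (rule measurable_prob_algebraD)
    have sets_Pt: "sets (P t \<eta>) = sets borel" and prob_Pt: "prob_space (P t \<eta>)" for \<eta>
      using measurable_space[OF Pt, of \<eta>] by (auto simp: space_prob_algebra)
    have T: "transition_operator P t (indicator A) \<eta> = measure (P t \<eta>) A" for \<eta>
      using sets_eq_imp_space_eq[OF sets_Pt[of \<eta>]] by (simp add: transition_operator_def)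
    have meas [measurable]: "(\<lambda>\<eta>. measure (P t \<eta>) A) \<in> borel_measurable borel"
      by measurable
    have int_T: "integrable \<mu> (\<lambda>\<eta>. measure (P t \<eta>) A)"
      by (rule integrable_const_bound[where B = 1])
         (auto simp: prob_space.prob_le_1[OF prob_Pt])
    have int_A: "integrable \<mu> (indicator A :: config \<Rightarrow> real)"
      by (rule integrable_const_bound[where B = 1]) (auto simp: indicator_def)
    have "measure \<mu> A = measure (\<mu> \<bind> P t) A"
      using stationary_distributionD(4)[OF \<mu>] t by simp
    also have "\<dots> = (\<integral>\<eta>. measure (P t \<eta>) A \<partial>\<mu>)"
      by (rule measure_bind[where N = borel]) measurable
    finally have inv: "(\<integral>\<eta>. measure (P t \<eta>) A \<partial>\<mu>) = measure \<mu> A" ..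
    have int_d: "integrable \<mu> (?d t)"
      unfolding T using int_T int_A by simp
    have "(\<integral>\<eta>. ?d t \<eta> \<partial>\<mu>) = 0"
      unfolding T using int_T int_A inv stationary_distributionD(3)[OF \<mu>] by simp
    then have "\<bar>\<integral>\<eta>. g \<eta> \<partial>\<mu>\<bar> = \<bar>\<integral>\<eta>. g \<eta> - ?d t \<eta> \<partial>\<mu>\<bar>"
      by (simp only: Bochner_Integration.integral_diff[OF int_g int_d] diff_zero)
    also have "\<dots> \<le> (\<integral>\<eta>. \<bar>g \<eta> - ?d t \<eta>\<bar> \<partial>\<mu>)"
      by (rule integral_abs_bound)
    also have "\<dots> \<le> (\<integral>\<eta>. e \<partial>\<mu>)"
      using int_g int_d close
      by (intro integral_mono) (auto simp: dist_real_def abs_minus_commute intro: less_imp_le)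
    finally show ?thesis
      by (simp add: prob_space)
  qed
  then have "\<bar>\<integral>\<eta>. g \<eta> \<partial>\<mu>\<bar> \<le> 0"
    by (rule field_le_epsilon[of _ 0, unfolded add_0])
  then show ?thesis by simp
qed

section \<open>The flux as a net flow\<close>

text \<open>
  The net flow from left to right across the bond \<open>(i, i + 1)\<close>, defined for any measure \<open>\<mu>\<close>,
  stationary or not.
\<close>

definition net_flow ::
    "(int \<Rightarrow> real) \<Rightarrow> (int \<Rightarrow> real) \<Rightarrow> config measure \<Rightarrow> int \<Rightarrow> real" where
  "net_flow p q \<mu> i = p i * measure \<mu> {\<eta>. \<eta> i \<and> \<not> \<eta> (i + 1)}
                   - q (i + 1) * measure \<mu> {\<eta>. \<not> \<eta> i \<and> \<eta> (i + 1)}"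

text \<open>Only exchanges across the two bonds at \<open>i\<close> change the occupation of site \<open>i\<close>.\<close>

lemma exclusion_generator_occupied:
  "exclusion_generator p q (indicator {\<eta>. \<eta> i}) \<eta> =
     (p (i - 1) * indicator {\<eta>. \<eta> (i - 1) \<and> \<not> \<eta> i} \<eta>
        - q i * indicator {\<eta>. \<not> \<eta> (i - 1) \<and> \<eta> i} \<eta>)
     - (p i * indicator {\<eta>. \<eta> i \<and> \<not> \<eta> (i + 1)} \<eta>
        - q (i + 1) * indicator {\<eta>. \<not> \<eta> i \<and> \<eta> (i + 1)} \<eta>)"
proof -
  let ?s = "\<lambda>j. (of_bool (\<eta> j) * (1 - of_bool (\<eta> (j + 1))) * p j
         + of_bool (\<eta> (j + 1)) * (1 - of_bool (\<eta> j)) * q (j + 1))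
        * (indicator {\<eta>. \<eta> i} (swap \<eta> j) - indicator {\<eta>. \<eta> i} \<eta>) :: real"
  have "exclusion_generator p q (indicator {\<eta>. \<eta> i}) \<eta> = infsum ?s {i - 1, i}"
    unfolding exclusion_generator_def
    by (rule infsum_cong_neutral) (auto simp: swap_def indicator_def)
  also have "\<dots> = ?s (i - 1) + ?s i"
    by simp
  finally show ?thesis
    by (simp add: swap_def indicator_def)
qed

lemma net_flow_eq_flux:
  assumes P: "exclusion_process p q P" and \<mu>: "\<mu> \<in> stationary_distributions P"
  shows "net_flow p q \<mu> i = flux p q \<mu>"
proof -
  interpret prob_space \<mu> using \<mu> by (rule stationary_distributionD)
  note [measurable_cong] = stationary_distributionD(2)[OF \<mu>]
  note space_\<mu> [simp] = stationary_distributionD(3)[OF \<mu>]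
  have step: "net_flow p q \<mu> (i - 1) = net_flow p q \<mu> i" for i
  proof -
    let ?g = "exclusion_generator p q (indicator {\<eta>. \<eta> i})"
    have meas: "?g \<in> borel_measurable borel"
      unfolding exclusion_generator_occupied[abs_def] by measurable
    have "depends_on_finitely_many (indicator {\<eta>. \<eta> i})"
      unfolding depends_on_finitely_many_def
      by (rule exI[of _ "{i}"]) (auto simp: indicator_def)
    then have gen: "generator_maps P (indicator {\<eta>. \<eta> i}) ?g"
      using P by (simp add: exclusion_process_def)
    have bound: "\<bar>?g \<eta>\<bar> \<le> \<bar>p (i - 1)\<bar> + \<bar>q i\<bar> + \<bar>p i\<bar> + \<bar>q (i + 1)\<bar>" for \<eta>
      unfolding exclusion_generator_occupied by (auto simp: indicator_def)
    have "(\<integral>\<eta>. ?g \<eta> \<partial>\<mu>) = 0"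
      using P by (intro integral_generator_eq_0[OF _ \<mu> _ meas bound gen])
        (auto simp: exclusion_process_def)
    moreover have "integrable \<mu> (\<lambda>\<eta>. c * indicator {\<eta>. Q \<eta>} \<eta> :: real)"
      if [measurable]: "Measurable.pred borel Q" for c Q
      by (rule integrable_const_bound[where B = "\<bar>c\<bar>"]) (auto simp: indicator_def)
    ultimately show ?thesis
      unfolding exclusion_generator_occupied net_flow_def by simp
  qed
  have const: "net_flow p q \<mu> j = net_flow p q \<mu> 0" for j
  proof (induction j rule: int_induct[where k = 0])
    case (step1 j) then show ?case using step[of "j + 1"] by simp
  next
    case (step2 j) then show ?case using step[of j] by simp
  qed simp
  have "flux p q \<mu> = (THE c. \<forall>i. c = net_flow p q \<mu> i)"
    unfolding flux_def net_flow_def ..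
  also have "\<dots> = net_flow p q \<mu> 0"
  proof (rule the_equality)
    show "\<forall>i. net_flow p q \<mu> 0 = net_flow p q \<mu> i"
      by (rule allI) (rule const[symmetric])
    show "c = net_flow p q \<mu> 0" if "\<forall>i. c = net_flow p q \<mu> i" for c
      using that by (rule spec)
  qed
  also have "\<dots> = net_flow p q \<mu> i"
    by (rule const[symmetric])
  finally show ?thesis ..
qed

section \<open>Bounds on the net flow\<close>

text \<open>The pattern 11 contributes to the densities of both sites and cancels in their difference.\<close>

lemma pattern_probabilities:
  fixes \<mu> :: "config measure" and i :: int
  assumes "prob_space \<mu>" and sets_\<mu> [measurable_cong]: "sets \<mu> = sets borel"
  defines "a \<equiv> measure \<mu> {\<eta>. \<eta> i \<and> \<not> \<eta> (i + 1)}"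
    and "b \<equiv> measure \<mu> {\<eta>. \<not> \<eta> i \<and> \<eta> (i + 1)}"
  shows "a - b = measure \<mu> {\<eta>. \<eta> i} - measure \<mu> {\<eta>. \<eta> (i + 1)}" and "a + b \<le> 1"
proof -
  interpret prob_space \<mu> by fact
  have [measurable]: "{\<eta>. Q \<eta>} \<in> sets \<mu>" if "Measurable.pred borel Q" for Q
    using that sets_\<mu> by (simp add: pred_def)
  have "measure \<mu> {\<eta>. \<eta> i} = a + measure \<mu> {\<eta>. \<eta> i \<and> \<eta> (i + 1)}"
    unfolding a_def by (subst finite_measure_Union[symmetric])
      (auto intro!: arg_cong[where f = "measure \<mu>"])
  moreover have "measure \<mu> {\<eta>. \<eta> (i + 1)} = b + measure \<mu> {\<eta>. \<eta> i \<and> \<eta> (i + 1)}"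
    unfolding b_def by (subst finite_measure_Union[symmetric])
      (auto intro!: arg_cong[where f = "measure \<mu>"])
  ultimately show "a - b = measure \<mu> {\<eta>. \<eta> i} - measure \<mu> {\<eta>. \<eta> (i + 1)}"
    by simp
  have "a + b = measure \<mu> ({\<eta>. \<eta> i \<and> \<not> \<eta> (i + 1)} \<union> {\<eta>. \<not> \<eta> i \<and> \<eta> (i + 1)})"
    unfolding a_def b_def by (rule finite_measure_Union[symmetric]) auto
  then show "a + b \<le> 1" by simp
qed

lemma net_flow_lower_bound:
  assumes \<mu>: "prob_space \<mu>" "sets \<mu> = sets borel" and "\<epsilon> \<ge> 0"
    and "p i \<ge> 1/2 - \<epsilon>" and "q (i + 1) \<le> 1/2 + \<epsilon>"
  shows "net_flow p q \<mu> i \<ge> (measure \<mu> {\<eta>. \<eta> i} - measure \<mu> {\<eta>. \<eta> (i + 1)}) / 2 - \<epsilon>"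
proof -
  define a b where "a = measure \<mu> {\<eta>. \<eta> i \<and> \<not> \<eta> (i + 1)}"
    and "b = measure \<mu> {\<eta>. \<not> \<eta> i \<and> \<eta> (i + 1)}"
  note ab = pattern_probabilities[OF \<mu>, of i, folded a_def b_def]
  have "\<epsilon> * (a + b) \<le> \<epsilon>"
    using mult_left_mono[OF ab(2) \<open>\<epsilon> \<ge> 0\<close>] by simp
  then have "(a - b) / 2 - \<epsilon> \<le> (1/2 - \<epsilon>) * a - (1/2 + \<epsilon>) * b"
    by (simp add: field_simps)
  also have "\<dots> \<le> p i * a - q (i + 1) * b"
    using assms by (intro diff_mono mult_right_mono) (auto simp: a_def b_def)
  finally show ?thesis
    by (simp add: net_flow_def a_def b_def ab(1)[unfolded a_def b_def])
qed

lemma net_flow_upper_bound: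
  assumes \<mu>: "prob_space \<mu>" "sets \<mu> = sets borel" and "\<epsilon> \<ge> 0"
    and "p i \<le> 1/2 + \<epsilon>" and "q (i + 1) \<ge> 1/2 - \<epsilon>"
  shows "net_flow p q \<mu> i \<le> (measure \<mu> {\<eta>. \<eta> i} - measure \<mu> {\<eta>. \<eta> (i + 1)}) / 2 + \<epsilon>"
proof -
  define a b where "a = measure \<mu> {\<eta>. \<eta> i \<and> \<not> \<eta> (i + 1)}"
    and "b = measure \<mu> {\<eta>. \<not> \<eta> i \<and> \<eta> (i + 1)}"
  note ab = pattern_probabilities[OF \<mu>, of i, folded a_def b_def]
  have "p i * a - q (i + 1) * b \<le> (1/2 + \<epsilon>) * a - (1/2 - \<epsilon>) * b"
    using assms by (intro diff_mono mult_right_mono) (auto simp: a_def b_def)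
  also have "\<epsilon> * (a + b) \<le> \<epsilon>"
    using mult_left_mono[OF ab(2) \<open>\<epsilon> \<ge> 0\<close>] by simp
  then have "(1/2 + \<epsilon>) * a - (1/2 - \<epsilon>) * b \<le> (a - b) / 2 + \<epsilon>"
    by (simp add: field_simps)
  finally show ?thesis
    by (simp add: net_flow_def a_def b_def ab(1)[unfolded a_def b_def])
qed

section \<open>Telescoping over long intervals\<close>

lemma nonneg_if_multiples_bounded_below:
  fixes x C :: real
  assumes "\<And>n::nat. n > 0 \<Longrightarrow> real n * x \<ge> - C"
  shows "x \<ge> 0"
proof (rule ccontr)
  assume "\<not> x \<ge> 0"
  then have "- x > 0" by simp
  \<comment> \<open>The maximum with 0 forces \<open>n\<close> to be positive even if \<open>C\<close> is negative.\<close>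
  from reals_Archimedean3[OF this] obtain n :: nat where n: "max C 0 < real n * (- x)"
    by blast
  then have "n > 0" by (cases n) auto
  then show False using assms[of n] n by simp
qed

text \<open>
  The telescoping argument: only the existence of arbitrarily long intervals is needed, not their
  position, because \<open>\<rho>\<close> is bounded uniformly.
\<close>

lemma nonneg_if_dominates_increments:
  fixes \<rho> :: "int \<Rightarrow> real"
  assumes \<rho>: "\<And>i. 0 \<le> \<rho> i" "\<And>i. \<rho> i \<le> 1"
    and x: "\<And>n::nat. n > 0 \<Longrightarrow> \<exists>k. \<forall>i. k \<le> i \<and> i < k + int n \<longrightarrow> \<rho> i - \<rho> (i + 1) \<le> x"
  shows "x \<ge> 0"
proof (rule nonneg_if_multiples_bounded_below)
  fix n :: nat assume "n > 0"
  then obtain k where k: "\<forall>i. k \<le> i \<and> i < k + int n \<longrightarrow> \<rho> i - \<rho> (i + 1) \<le> x"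
    using x by blast
  have "\<rho> k - \<rho> (k + int m) \<le> real m * x" if "m \<le> n" for m
    using that
  proof (induction m)
    case (Suc m)
    then have "\<rho> (k + int m) - \<rho> (k + int m + 1) \<le> x"
      using k by simp
    with Suc show ?case by (simp add: algebra_simps)
  qed simp
  from this[of n] show "real n * x \<ge> - 1"
    using \<rho>(1)[of k] \<rho>(2)[of "k + int n"] by simp
qed

theorem proposition1:
  fixes p q :: "int \<Rightarrow> real" and P :: "real \<Rightarrow> config \<Rightarrow> config measure" and \<epsilon> :: real
  assumes "\<And>i. 0 < p i \<and> p i < 1"
    and "\<And>i. q i = 1 - p i"
    and "exclusion_process p q P"
    and "\<epsilon> > 0"
  shows "((\<forall>n::nat. n > 0 \<longrightarrow> (\<exists>k::int. \<forall>i. k \<le> i \<and> i \<le> k + int n \<longrightarrow> p i \<ge> 1/2 - \<epsilon>))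
            \<longrightarrow> (\<forall>\<mu>\<in>stationary_distributions P. flux p q \<mu> \<ge> - \<epsilon>))
       \<and> ((\<forall>n::nat. n > 0 \<longrightarrow> (\<exists>k::int. \<forall>i. k \<le> i \<and> i \<le> k + int n \<longrightarrow> p i \<le> 1/2 + \<epsilon>))
            \<longrightarrow> (\<forall>\<mu>\<in>stationary_distributions P. flux p q \<mu> \<le> \<epsilon>))"
proof (intro conjI impI ballI)
  fix \<mu>
  assume p_ge: "\<forall>n::nat. n > 0 \<longrightarrow>
      (\<exists>k::int. \<forall>i. k \<le> i \<and> i \<le> k + int n \<longrightarrow> p i \<ge> 1/2 - \<epsilon>)"
    and \<mu>: "\<mu> \<in> stationary_distributions P"
  note prob = stationary_distributionD(1,2)[OF \<mu>]
  note flux = net_flow_eq_flux[OF assms(3) \<mu>]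
  have "2 * (flux p q \<mu> + \<epsilon>) \<ge> 0"
  proof (rule nonneg_if_dominates_increments[where \<rho> = "\<lambda>i. measure \<mu> {\<eta>. \<eta> i}"])
    fix n :: nat assume "n > 0"
    then obtain k where k: "\<forall>i. k \<le> i \<and> i \<le> k + int n \<longrightarrow> p i \<ge> 1/2 - \<epsilon>"
      using p_ge by blast
    have "measure \<mu> {\<eta>. \<eta> i} - measure \<mu> {\<eta>. \<eta> (i + 1)} \<le> 2 * (flux p q \<mu> + \<epsilon>)"
      if "k \<le> i" "i < k + int n" for i
    proof -
      have p: "p i \<ge> 1/2 - \<epsilon>" "p (i + 1) \<ge> 1/2 - \<epsilon>"
        using k that by auto
      then have "q (i + 1) \<le> 1/2 + \<epsilon>"
        using assms(2)[of "i + 1"] by linarith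
      then show ?thesis
        using net_flow_lower_bound[OF prob less_imp_le[OF \<open>\<epsilon> > 0\<close>], of p i q, OF p(1)]
        unfolding flux by (simp add: field_simps)
    qed
    then show "\<exists>k. \<forall>i. k \<le> i \<and> i < k + int n \<longrightarrow>
        measure \<mu> {\<eta>. \<eta> i} - measure \<mu> {\<eta>. \<eta> (i + 1)} \<le> 2 * (flux p q \<mu> + \<epsilon>)"
      by blast
  qed (use prob_space.prob_le_1[OF prob(1)] in auto)
  then show "flux p q \<mu> \<ge> - \<epsilon>" by simp
next
  fix \<mu>
  assume p_le: "\<forall>n::nat. n > 0 \<longrightarrow>
      (\<exists>k::int. \<forall>i. k \<le> i \<and> i \<le> k + int n \<longrightarrow> p i \<le> 1/2 + \<epsilon>)"
    and \<mu>: "\<mu> \<in> stationary_distributions P"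
  note prob = stationary_distributionD(1,2)[OF \<mu>]
  note flux = net_flow_eq_flux[OF assms(3) \<mu>]
  have "2 * (\<epsilon> - flux p q \<mu>) \<ge> 0"
  \<comment> \<open>The increments change sign, so the profile to telescope is the density of empty sites.\<close>
  proof (rule nonneg_if_dominates_increments[where \<rho> = "\<lambda>i. 1 - measure \<mu> {\<eta>. \<eta> i}"])
    fix n :: nat assume "n > 0"
    then obtain k where k: "\<forall>i. k \<le> i \<and> i \<le> k + int n \<longrightarrow> p i \<le> 1/2 + \<epsilon>"
      using p_le by blast
    have "(1 - measure \<mu> {\<eta>. \<eta> i}) - (1 - measure \<mu> {\<eta>. \<eta> (i + 1)}) \<le> 2 * (\<epsilon> - flux p q \<mu>)"
      if "k \<le> i" "i < k + int n" for i
    proof -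
      have p: "p i \<le> 1/2 + \<epsilon>" "p (i + 1) \<le> 1/2 + \<epsilon>"
        using k that by auto
      then have "q (i + 1) \<ge> 1/2 - \<epsilon>"
        using assms(2)[of "i + 1"] by linarith
      then show ?thesis
        using net_flow_upper_bound[OF prob less_imp_le[OF \<open>\<epsilon> > 0\<close>], of p i q, OF p(1)]
        unfolding flux by (simp add: field_simps)
    qed
    then show "\<exists>k. \<forall>i. k \<le> i \<and> i < k + int n \<longrightarrow>
        (1 - measure \<mu> {\<eta>. \<eta> i}) - (1 - measure \<mu> {\<eta>. \<eta> (i + 1)}) \<le> 2 * (\<epsilon> - flux p q \<mu>)"
      by blast
  qed (use prob_space.prob_le_1[OF prob(1)] in auto)
  then show "flux p q \<mu> \<le> \<epsilon>" by simp
qed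

end
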